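(* Let $\Gamma=(V,E)$ be a connected regular graph of degree $k$, and let $S$ be a set of $(s+1)$-cliques of $\Gamma$ such that every edge of $\Gamma$ is contained in exactly $m$ cliques from $S$ (i.e. $(\Gamma,S)$ is a $(k,s,m)$ pair). Let $T=(T_0,T_1)$ be a pair of disjoint nonempty independent sets of vertices of $\Gamma$. Then the following are equivalent: (a) $T$ is an $S$-bitrade. (b) The function $f^T:V\to\mathbb{R}$ defined by $f^T(x)=(-1)^i$ if $x\in T_i$ ($i\in\{0,1\}$) and $f^T(x)=0$ otherwise, is an eigenfunction of $\Gamma$ with eigenvalue $\theta=-k/s$. (c) The subgraph $\Gamma^T$ of $\Gamma$ induced by the vertex set $T_0\cup T_1$ is regular of degree $-\theta=k/s$ (this subgraph is bipartite with parts $T_0,T_1$).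
   Context: An eigenfunction of a graph $\Gamma=(V,E)$ is a function $f:V\to\mathbb{R}$, not identically zero, such that $\sum_{y\in\Gamma_1(x)} f(y)=\theta f(x)$ for all $x\in V$ and some constant $\theta$ (the eigenvalue), where $\Gamma_1(x)$ is the set of neighbours of $x$. A pair $(T_0,T_1)$ of mutually disjoint nonempty sets of vertices is an $S$-bitrade if every clique from $S$ either intersects each of $T_0$ and $T_1$ in exactly one vertex, or intersects neither of them. *)

theory Defs
  imports Complex_Main
begin

text \<open>A simple graph \<open>(V, E)\<close> has as edges two-element sets of vertices. Finiteness of \<open>V\<close> is not
  imposed: regularity below makes the graphs under consideration locally finite.\<close>

definition simple_graph :: "'a set \<Rightarrow> 'a set set \<Rightarrow> bool" where
  "simple_graph V E \<longleftrightarrow> (\<forall>e\<in>E. e \<subseteq> V \<and> card e = 2)"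

definition neighbours :: "'a set set \<Rightarrow> 'a \<Rightarrow> 'a set" where
  "neighbours E x = {y. {x, y} \<in> E}"

definition connected_graph :: "'a set \<Rightarrow> 'a set set \<Rightarrow> bool" where
  "connected_graph V E \<longleftrightarrow> V \<noteq> {} \<and> (\<forall>x\<in>V. \<forall>y\<in>V. (x, y) \<in> {(u, v). {u, v} \<in> E}\<^sup>*)"

text \<open>The degree is a real number, so that one may speak of regularity of degree \<open>k / s\<close> without
  presupposing that \<open>s\<close> divides \<open>k\<close>. The finiteness condition is needed because \<open>card\<close> is \<open>0\<close> on
  infinite sets.\<close>

definition regular_graph :: "'a set \<Rightarrow> 'a set set \<Rightarrow> real \<Rightarrow> bool" where
  "regular_graph V E d \<longleftrightarrow>
     (\<forall>x\<in>V. finite (neighbours E x) \<and> real (card (neighbours E x)) = d)"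

definition induced_edges :: "'a set set \<Rightarrow> 'a set \<Rightarrow> 'a set set" where
  "induced_edges E U = {e \<in> E. e \<subseteq> U}"

definition independent_set :: "'a set \<Rightarrow> 'a set set \<Rightarrow> 'a set \<Rightarrow> bool" where
  "independent_set V E A \<longleftrightarrow> A \<subseteq> V \<and> (\<forall>x\<in>A. \<forall>y\<in>A. {x, y} \<notin> E)"

definition bipartite_with_parts :: "'a set \<Rightarrow> 'a set set \<Rightarrow> 'a set \<Rightarrow> 'a set \<Rightarrow> bool" where
  "bipartite_with_parts V E A B \<longleftrightarrow>
     A \<union> B = V \<and> A \<inter> B = {} \<and> (\<forall>e\<in>E. \<exists>a\<in>A. \<exists>b\<in>B. e = {a, b})"

definition clique :: "'a set \<Rightarrow> 'a set set \<Rightarrow> 'a set \<Rightarrow> bool" where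
  "clique V E C \<longleftrightarrow> C \<subseteq> V \<and> (\<forall>x\<in>C. \<forall>y\<in>C. x \<noteq> y \<longrightarrow> {x, y} \<in> E)"

text \<open>The parameters \<open>s\<close> and \<open>m\<close> are positive: for \<open>m = 0\<close> the empty family of cliques would
  qualify, and for \<open>s = 0\<close> the quotient \<open>k / s\<close> is meaningless.\<close>

definition ksm_pair ::
  "'a set \<Rightarrow> 'a set set \<Rightarrow> 'a set set \<Rightarrow> nat \<Rightarrow> nat \<Rightarrow> nat \<Rightarrow> bool" where
  "ksm_pair V E S k s m \<longleftrightarrow>
     s \<ge> 1 \<and> m \<ge> 1 \<and>
     simple_graph V E \<and> connected_graph V E \<and> regular_graph V E (real k) \<and>
     (\<forall>C\<in>S. clique V E C \<and> card C = s + 1) \<and>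
     (\<forall>e\<in>E. card {C \<in> S. e \<subseteq> C} = m)"

definition bitrade :: "'a set \<Rightarrow> 'a set set \<Rightarrow> 'a set \<Rightarrow> 'a set \<Rightarrow> bool" where
  "bitrade V S T0 T1 \<longleftrightarrow>
     T0 \<subseteq> V \<and> T1 \<subseteq> V \<and> T0 \<noteq> {} \<and> T1 \<noteq> {} \<and> T0 \<inter> T1 = {} \<and>
     (\<forall>C\<in>S. (card (C \<inter> T0) = 1 \<and> card (C \<inter> T1) = 1) \<or> (C \<inter> T0 = {} \<and> C \<inter> T1 = {}))"

text \<open>A function on \<open>V\<close> is represented by a function on the whole type; only its values on \<open>V\<close>
  matter.\<close>

definition eigenfunction ::
  "'a set \<Rightarrow> 'a set set \<Rightarrow> ('a \<Rightarrow> real) \<Rightarrow> real \<Rightarrow> bool" where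
  "eigenfunction V E f \<theta> \<longleftrightarrow>
     (\<exists>x\<in>V. f x \<noteq> 0) \<and> (\<forall>x\<in>V. (\<Sum>y\<in>neighbours E x. f y) = \<theta> * f x)"

definition bitrade_fun :: "'a set \<Rightarrow> 'a set \<Rightarrow> 'a \<Rightarrow> real" where
  "bitrade_fun T0 T1 x = (if x \<in> T0 then 1 else if x \<in> T1 then - 1 else 0)"

end

(* Counting the cliques of S through a vertex x in two ways turns the eigenvalue equation for
   - k / s at x into the condition that the sum of f(C) over the cliques C in S through x vanishes,
   where f(C) is the sum of f over C. As a clique meets an independent set in at most one vertex,
   for f = f^T and x in T_0 all the f(C) are nonnegative (for x in T_1 nonpositive), so that they
   all vanish. Hence the eigenvalue equation at the vertices of T_0 and T_1 alone already
   forces T to be a bitrade; and at these vertices it is the degree condition. *)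

theory Submission
  imports Defs
begin

section \<open>Double counting of the cliques through a vertex\<close>

lemma simple_graph_irrefl: "simple_graph V E \<Longrightarrow> {x, x} \<notin> E"
  by (force simp: simple_graph_def)

lemma ksm_pair_finite_clique:
  assumes "ksm_pair V E S k s m" "C \<in> S"
  shows "finite C"
proof (rule ccontr)
  assume "infinite C"
  then have "card C = 0"
    by simp
  with assms show False
    by (simp add: ksm_pair_def)
qed

text \<open>Rewrites \<open>C - {x}\<close> as a restriction of \<open>neighbours E x\<close>, the
  shape in which \<open>sum.swap_restrict\<close> can exchange summation over cliques with summation
  over neighbours.\<close>

lemma ksm_pair_clique_minus:
  assumes "ksm_pair V E S k s m" "C \<in> S" "x \<in> C"
  shows "C - {x} = {y \<in> neighbours E x. y \<in> C}"
proof -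
  have "clique V E C" "simple_graph V E"
    using assms by (auto simp: ksm_pair_def)
  then show ?thesis
    using assms simple_graph_irrefl[of V E x] by (auto simp: clique_def neighbours_def)
qed

lemma ksm_pair_finite_neighbours:
  "ksm_pair V E S k s m \<Longrightarrow> x \<in> V \<Longrightarrow> finite (neighbours E x)"
  by (simp add: ksm_pair_def regular_graph_def)

text \<open>Neither \<open>V\<close> nor \<open>S\<close> is assumed finite, so this has to come
  from local finiteness: a clique through \<open>x\<close> has at least two vertices, hence contains
  one of the finitely many edges at \<open>x\<close>, and each edge lies in only finitely many
  cliques of \<open>S\<close>.\<close>

lemma ksm_pair_finite_cliques_at:
  assumes ksm: "ksm_pair V E S k s m" and x: "x \<in> V"
  shows "finite {C \<in> S. x \<in> C}"
proof -
  have "finite {C \<in> S. {x, y} \<subseteq> C}" if "y \<in> neighbours E x" for y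
  proof -
    \<comment> \<open>As \<open>card\<close> is 0 on infinite sets, \<open>m \<ge> 1\<close> is what
      turns this cardinality into finiteness.\<close>
    have "card {C \<in> S. {x, y} \<subseteq> C} = m" "m \<ge> 1"
      using that ksm by (auto simp: ksm_pair_def neighbours_def)
    then show ?thesis
      by (metis card.infinite not_one_le_zero)
  qed
  then have "finite (\<Union>y\<in>neighbours E x. {C \<in> S. {x, y} \<subseteq> C})"
    using ksm_pair_finite_neighbours[OF ksm x] by (intro finite_UN_I)
  moreover have "{C \<in> S. x \<in> C} \<subseteq> (\<Union>y\<in>neighbours E x. {C \<in> S. {x, y} \<subseteq> C})"
  proof
    fix C assume C: "C \<in> {C \<in> S. x \<in> C}"
    then have "card C = s + 1" "s \<ge> 1"
      using ksm by (auto simp: ksm_pair_def)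
    then have "card (C - {x}) \<noteq> 0"
      using C by simp
    then obtain y where "y \<in> C - {x}"
      by (metis card.empty ex_in_conv)
    then show "C \<in> (\<Union>y\<in>neighbours E x. {C \<in> S. {x, y} \<subseteq> C})"
      using C ksm_pair_clique_minus[OF ksm, of C x] by auto
  qed
  ultimately show ?thesis
    by (rule finite_subset[rotated])
qed

text \<open>Sum \<open>f y\<close> over all pairs of a clique \<open>C\<close> through
  \<open>x\<close> and a vertex \<open>y\<close> of \<open>C\<close> other than \<open>x\<close>: a
  neighbour \<open>y\<close> occurs once for each of the \<open>m\<close> cliques that contain the
  edge \<open>{x, y}\<close>.\<close>

lemma ksm_pair_sum_cliques_minus:
  fixes f :: "'a \<Rightarrow> real"
  assumes ksm: "ksm_pair V E S k s m" and x: "x \<in> V"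
  shows "(\<Sum>C | C \<in> S \<and> x \<in> C. \<Sum>y\<in>C - {x}. f y) = real m * (\<Sum>y\<in>neighbours E x. f y)"
proof -
  have "(\<Sum>C | C \<in> S \<and> x \<in> C. \<Sum>y\<in>C - {x}. f y)
      = (\<Sum>C | C \<in> S \<and> x \<in> C. \<Sum>y | y \<in> neighbours E x \<and> y \<in> C. f y)"
    using ksm_pair_clique_minus[OF ksm] by (intro sum.cong) auto
  also have "\<dots> = (\<Sum>y\<in>neighbours E x. \<Sum>C | C \<in> {C \<in> S. x \<in> C} \<and> y \<in> C. f y)"
    using ksm_pair_finite_cliques_at[OF ksm x] ksm_pair_finite_neighbours[OF ksm x]
    by (rule sum.swap_restrict)
  also have "\<dots> = (\<Sum>y\<in>neighbours E x. real m * f y)"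
  proof (intro sum.cong refl)
    fix y assume "y \<in> neighbours E x"
    then have "card {C \<in> S. {x, y} \<subseteq> C} = m"
      using ksm by (auto simp: ksm_pair_def neighbours_def)
    moreover have "{C. C \<in> {C \<in> S. x \<in> C} \<and> y \<in> C} = {C \<in> S. {x, y} \<subseteq> C}"
      by auto
    ultimately show "(\<Sum>C | C \<in> {C \<in> S. x \<in> C} \<and> y \<in> C. f y) = real m * f y"
      by simp
  qed
  finally show ?thesis
    by (simp add: sum_distrib_left)
qed

text \<open>The preceding count for the constant function 1: every clique through \<open>x\<close>
  contributes its \<open>s\<close> other vertices.\<close>

lemma ksm_pair_card_cliques_at:
  assumes ksm: "ksm_pair V E S k s m" and x: "x \<in> V"
  shows "real (card {C \<in> S. x \<in> C}) * real s = real m * real k"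
proof -
  have "real (card {C \<in> S. x \<in> C}) * real s = (\<Sum>C | C \<in> S \<and> x \<in> C. \<Sum>y\<in>C - {x}. (1::real))"
    using ksm by (simp add: ksm_pair_def)
  also have "\<dots> = real m * real (card (neighbours E x))"
    using ksm_pair_sum_cliques_minus[OF ksm x, of "\<lambda>_. 1"] by simp
  also have "\<dots> = real m * real k"
    using ksm x by (simp add: ksm_pair_def regular_graph_def)
  finally show ?thesis .
qed

text \<open>Splitting off the term of \<open>x\<close> in each clique and counting
  \<open>m * k / s\<close> cliques through \<open>x\<close> shows that the sum on the right is
  \<open>m\<close> times the difference of the two sides on the left, and \<open>m\<close> is
  positive.\<close>

lemma ksm_pair_eigen_eq_iff:
  fixes f :: "'a \<Rightarrow> real"
  assumes ksm: "ksm_pair V E S k s m" and x: "x \<in> V"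
  shows "(\<Sum>y\<in>neighbours E x. f y) = - (real k / real s) * f x \<longleftrightarrow>
    (\<Sum>C | C \<in> S \<and> x \<in> C. \<Sum>y\<in>C. f y) = 0"
proof -
  have pos: "real s > 0" "real m > 0"
    using ksm by (auto simp: ksm_pair_def)
  have "(\<Sum>C | C \<in> S \<and> x \<in> C. \<Sum>y\<in>C. f y)
      = (\<Sum>C | C \<in> S \<and> x \<in> C. f x + (\<Sum>y\<in>C - {x}. f y))"
    using ksm_pair_finite_clique[OF ksm] by (intro sum.cong refl sum.remove) auto
  also have "\<dots> = real (card {C \<in> S. x \<in> C}) * f x + real m * (\<Sum>y\<in>neighbours E x. f y)"
    by (simp add: sum.distrib ksm_pair_sum_cliques_minus[OF ksm x])
  also have "real (card {C \<in> S. x \<in> C}) = real m * (real k / real s)"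
    using ksm_pair_card_cliques_at[OF ksm x] pos by (simp add: field_simps)
  finally have "(\<Sum>C | C \<in> S \<and> x \<in> C. \<Sum>y\<in>C. f y)
      = real m * ((\<Sum>y\<in>neighbours E x. f y) + real k / real s * f x)"
    by (simp add: algebra_simps)
  then show ?thesis
    using pos by (auto simp: add_eq_0_iff2)
qed

section \<open>Clique sums of f^T, bitrades and the eigenvalue equation\<close>

lemma sum_bitrade_fun:
  assumes "finite A" "T0 \<inter> T1 = {}"
  shows "(\<Sum>y\<in>A. bitrade_fun T0 T1 y) = real (card (A \<inter> T0)) - real (card (A \<inter> T1))"
proof -
  have "bitrade_fun T0 T1 y = of_bool (y \<in> T0) - of_bool (y \<in> T1)" for y
    using assms(2) by (auto simp: bitrade_fun_def)
  then show ?thesis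
    using assms(1) by (simp add: sum_subtractf Int_def)
qed

lemma bitrade_fun_swap:
  "T0 \<inter> T1 = {} \<Longrightarrow> bitrade_fun T1 T0 y = - bitrade_fun T0 T1 y"
  by (auto simp: bitrade_fun_def)

lemma card_clique_Int_independent_le:
  assumes "clique V E C" "independent_set V E A"
  shows "card (C \<inter> A) \<le> 1"
proof -
  have "u = v" if "u \<in> C \<inter> A" "v \<in> C \<inter> A" for u v
    using assms that unfolding clique_def independent_set_def by blast
  then show ?thesis
    using card_le_Suc0_iff_eq[of "C \<inter> A"] by (cases "finite (C \<inter> A)") auto
qed

lemma eigen_eq_imp_cliques:
  assumes ksm: "ksm_pair V E S k s m"
    and disj: "T0 \<inter> T1 = {}"
    and indep: "independent_set V E T0" "independent_set V E T1"
    and x: "x \<in> T0"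
    and eq: "(\<Sum>y\<in>neighbours E x. bitrade_fun T0 T1 y)
      = - (real k / real s) * bitrade_fun T0 T1 x"
    and C: "C \<in> S" "x \<in> C"
  shows "card (C \<inter> T0) = 1 \<and> card (C \<inter> T1) = 1"
proof -
  have xV: "x \<in> V"
    using x indep by (auto simp: independent_set_def)
  \<comment> \<open>So f^T sums over \<open>D\<close> to 1 or 0, and to 0 exactly when
    \<open>D\<close> meets \<open>T1\<close> in one vertex.\<close>
  have T0: "card (D \<inter> T0) = 1" and T1: "card (D \<inter> T1) \<le> 1"
    and D_sum: "(\<Sum>y\<in>D. bitrade_fun T0 T1 y) = real (card (D \<inter> T0)) - real (card (D \<inter> T1))"
    if "D \<in> S" "x \<in> D" for D
  proof -
    have fin: "finite D"
      using ksm_pair_finite_clique[OF ksm that(1)] .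
    have cl: "clique V E D"
      using ksm that by (auto simp: ksm_pair_def)
    have "card (D \<inter> T0) \<noteq> 0"
      using fin that x by auto
    then show "card (D \<inter> T0) = 1"
      using card_clique_Int_independent_le[OF cl indep(1)] by linarith
    show "card (D \<inter> T1) \<le> 1"
      by (rule card_clique_Int_independent_le[OF cl indep(2)])
    show "(\<Sum>y\<in>D. bitrade_fun T0 T1 y) = real (card (D \<inter> T0)) - real (card (D \<inter> T1))"
      by (rule sum_bitrade_fun[OF fin disj])
  qed
  have "(\<Sum>D | D \<in> S \<and> x \<in> D. \<Sum>y\<in>D. bitrade_fun T0 T1 y) = 0"
    using eq ksm_pair_eigen_eq_iff[OF ksm xV] by blast
  moreover have "(\<Sum>y\<in>D. bitrade_fun T0 T1 y) \<ge> 0" if "D \<in> {D. D \<in> S \<and> x \<in> D}" for D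
    using that T0[of D] T1[of D] D_sum[of D] by auto
  \<comment> \<open>A vanishing sum of nonnegative terms forces each term to vanish only over a
    finite index set, hence the appeal to the finiteness of the family of cliques through
    \<open>x\<close>.\<close>
  ultimately have "(\<Sum>y\<in>C. bitrade_fun T0 T1 y) = 0"
    using sum_nonneg_eq_0_iff[OF ksm_pair_finite_cliques_at[OF ksm xV],
        of "\<lambda>D. \<Sum>y\<in>D. bitrade_fun T0 T1 y"] C by auto
  then show ?thesis
    using D_sum[OF C] T0[OF C] by simp
qed

text \<open>Over each clique of \<open>S\<close> the values of f^T are one 1 and one -1 besides
  zeros, or zeros only, so every clique sum vanishes, whether or not \<open>x\<close> lies in a
  part.\<close>

lemma bitrade_imp_eigen_eq:
  assumes ksm: "ksm_pair V E S k s m" and bi: "bitrade V S T0 T1" and x: "x \<in> V"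
  shows "(\<Sum>y\<in>neighbours E x. bitrade_fun T0 T1 y) = - (real k / real s) * bitrade_fun T0 T1 x"
proof -
  have "(\<Sum>y\<in>C. bitrade_fun T0 T1 y) = 0" if "C \<in> S" for C
    using bi that sum_bitrade_fun[OF ksm_pair_finite_clique[OF ksm that], of T0 T1]
    by (auto simp: bitrade_def)
  then have "(\<Sum>C | C \<in> S \<and> x \<in> C. \<Sum>y\<in>C. bitrade_fun T0 T1 y) = 0"
    by simp
  then show ?thesis
    using ksm_pair_eigen_eq_iff[OF ksm x] by blast
qed

text \<open>The equation is asked for only on \<open>T0 \<union> T1\<close>, since a clique that
  meets neither part satisfies the bitrade condition anyway. This is what lets the degree condition
  be used as the hypothesis.\<close>

lemma eigen_eq_imp_bitrade:
  assumes ksm: "ksm_pair V E S k s m"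
    and ne: "T0 \<noteq> {}" "T1 \<noteq> {}" and disj: "T0 \<inter> T1 = {}"
    and indep: "independent_set V E T0" "independent_set V E T1"
    and eq: "\<And>x. x \<in> T0 \<union> T1 \<Longrightarrow> (\<Sum>y\<in>neighbours E x. bitrade_fun T0 T1 y)
      = - (real k / real s) * bitrade_fun T0 T1 x"
  shows "bitrade V S T0 T1"
proof -
  have disj': "T1 \<inter> T0 = {}"
    using disj by auto
  have "card (C \<inter> T0) = 1 \<and> card (C \<inter> T1) = 1" if "C \<in> S" "x \<in> C" "x \<in> T0" for C x
    using eigen_eq_imp_cliques[OF ksm disj indep that(3) eq that(1,2)] that by blast
  moreover have "card (C \<inter> T0) = 1 \<and> card (C \<inter> T1) = 1" if "C \<in> S" "x \<in> C" "x \<in> T1" for C x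
  proof -
    \<comment> \<open>Exchanging the parts negates f^T, and the equation is linear, so the case of
      \<open>T1\<close> reduces to that of \<open>T0\<close>.\<close>
    have "(\<Sum>y\<in>neighbours E x. bitrade_fun T1 T0 y) = - (real k / real s) * bitrade_fun T1 T0 x"
      using eq[of x] that by (simp add: bitrade_fun_swap[OF disj] sum_negf)
    from eigen_eq_imp_cliques[OF ksm disj' indep(2,1) that(3) this that(1,2)] show ?thesis
      by blast
  qed
  ultimately show ?thesis
    using ne disj indep unfolding bitrade_def independent_set_def by blast
qed

section \<open>Degrees in the induced subgraph, and the equivalence\<close>

lemma neighbours_induced_edges:
  assumes "x \<in> T0" "T0 \<inter> T1 = {}" "independent_set V E T0"
  shows "neighbours (induced_edges E (T0 \<union> T1)) x = neighbours E x \<inter> T1"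
  using assms by (auto simp: neighbours_def induced_edges_def independent_set_def)

text \<open>By independence, all neighbours of \<open>x\<close> inside \<open>T0 \<union> T1\<close>
  lie in the opposite part, where f^T takes the value \<open>- bitrade_fun T0 T1 x\<close>; the
  others contribute 0.\<close>

lemma sum_neighbours_bitrade_fun:
  assumes fin: "finite (neighbours E x)"
    and disj: "T0 \<inter> T1 = {}"
    and indep: "independent_set V E T0" "independent_set V E T1"
    and x: "x \<in> T0 \<union> T1"
  shows "(\<Sum>y\<in>neighbours E x. bitrade_fun T0 T1 y)
    = - real (card (neighbours (induced_edges E (T0 \<union> T1)) x)) * bitrade_fun T0 T1 x"
proof -
  note sum_f = sum_bitrade_fun[OF fin disj]
  show ?thesis
  proof (cases "x \<in> T0")
    case True
    have "neighbours E x \<inter> T0 = {}"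
      using True indep by (auto simp: neighbours_def independent_set_def)
    then show ?thesis
      using True sum_f neighbours_induced_edges[OF True disj indep(1)]
      by (simp add: bitrade_fun_def)
  next
    case False
    then have x1: "x \<in> T1"
      using x by blast
    have "neighbours E x \<inter> T1 = {}"
      using x1 indep by (auto simp: neighbours_def independent_set_def)
    moreover have "neighbours (induced_edges E (T0 \<union> T1)) x = neighbours E x \<inter> T0"
      using neighbours_induced_edges[OF x1 _ indep(2), of T0] disj by (simp add: Un_commute Int_commute)
    ultimately show ?thesis
      using False x1 sum_f by (simp add: bitrade_fun_def)
  qed
qed

text \<open>On \<open>T0 \<union> T1\<close> the function f^T is nonzero and can be cancelled, so
  the equation with eigenvalue \<open>- d\<close> at \<open>x\<close> says that \<open>x\<close> has
  degree \<open>d\<close> in the induced subgraph.\<close>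

lemma regular_induced_iff:
  assumes fin: "\<And>x. x \<in> T0 \<union> T1 \<Longrightarrow> finite (neighbours E x)"
    and disj: "T0 \<inter> T1 = {}"
    and indep: "independent_set V E T0" "independent_set V E T1"
  shows "regular_graph (T0 \<union> T1) (induced_edges E (T0 \<union> T1)) d \<longleftrightarrow>
    (\<forall>x\<in>T0 \<union> T1. (\<Sum>y\<in>neighbours E x. bitrade_fun T0 T1 y) = - d * bitrade_fun T0 T1 x)"
proof -
  have "finite (neighbours (induced_edges E (T0 \<union> T1)) x)" if "x \<in> T0 \<union> T1" for x
    using fin[OF that] by (rule finite_subset[rotated]) (auto simp: neighbours_def induced_edges_def)
  moreover have "bitrade_fun T0 T1 x \<noteq> 0" if "x \<in> T0 \<union> T1" for x
    using that by (auto simp: bitrade_fun_def)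
  ultimately show ?thesis
    unfolding regular_graph_def
    by (intro ball_cong refl) (simp add: sum_neighbours_bitrade_fun[OF fin disj indep])
qed

lemma bipartite_induced:
  assumes simple: "simple_graph V E"
    and disj: "T0 \<inter> T1 = {}"
    and indep: "independent_set V E T0" "independent_set V E T1"
  shows "bipartite_with_parts (T0 \<union> T1) (induced_edges E (T0 \<union> T1)) T0 T1"
proof -
  have "\<exists>a\<in>T0. \<exists>b\<in>T1. e = {a, b}" if "e \<in> E" "e \<subseteq> T0 \<union> T1" for e
  proof -
    have "card e = 2"
      using simple that by (simp add: simple_graph_def)
    then obtain u v where e: "e = {u, v}"
      by (auto simp: card_2_iff)
    have "\<not> (u \<in> T0 \<and> v \<in> T0)" "\<not> (u \<in> T1 \<and> v \<in> T1)"
      using indep that e by (auto simp: independent_set_def)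
    then show ?thesis
      using that e by (auto simp: insert_commute)
  qed
  then show ?thesis
    using disj by (auto simp: bipartite_with_parts_def induced_edges_def)
qed

theorem theorem1:
  fixes V :: "'a set" and E S :: "'a set set" and k s m :: nat and T0 T1 :: "'a set"
  assumes "ksm_pair V E S k s m"
    and "T0 \<noteq> {}" and "T1 \<noteq> {}" and "T0 \<inter> T1 = {}"
    and "independent_set V E T0" and "independent_set V E T1"
  shows "(bitrade V S T0 T1 \<longleftrightarrow>
            eigenfunction V E (bitrade_fun T0 T1) (- (real k / real s))) \<and>
         (eigenfunction V E (bitrade_fun T0 T1) (- (real k / real s)) \<longleftrightarrow>
            regular_graph (T0 \<union> T1) (induced_edges E (T0 \<union> T1)) (real k / real s)) \<and>
         bipartite_with_parts (T0 \<union> T1) (induced_edges E (T0 \<union> T1)) T0 T1"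
proof -
  let ?f = "bitrade_fun T0 T1" and ?d = "real k / real s"
  let ?eq_on = "\<lambda>U. \<forall>x\<in>U. (\<Sum>y\<in>neighbours E x. ?f y) = - ?d * ?f x"
  have sub: "T0 \<union> T1 \<subseteq> V"
    using assms(5,6) by (simp add: independent_set_def)
  obtain t where "t \<in> T0"
    using assms(2) by blast
  then have "\<exists>x\<in>V. ?f x \<noteq> 0"
    using sub by (intro bexI[of _ t]) (auto simp: bitrade_fun_def)
  then have eig: "eigenfunction V E ?f (- ?d) \<longleftrightarrow> ?eq_on V"
    by (simp add: eigenfunction_def)
  have reg: "regular_graph (T0 \<union> T1) (induced_edges E (T0 \<union> T1)) ?d \<longleftrightarrow> ?eq_on (T0 \<union> T1)"
    using sub ksm_pair_finite_neighbours[OF assms(1)]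
    by (intro regular_induced_iff[OF _ assms(4-6)]) auto
  \<comment> \<open>A cycle of three implications: the equation at the vertices outside both parts
    is recovered from the equation on the parts by way of the bitrade property.\<close>
  have "bitrade V S T0 T1 \<Longrightarrow> ?eq_on V"
    using bitrade_imp_eigen_eq[OF assms(1)] by blast
  moreover have "?eq_on V \<Longrightarrow> ?eq_on (T0 \<union> T1)"
    using sub by blast
  moreover have "?eq_on (T0 \<union> T1) \<Longrightarrow> bitrade V S T0 T1"
    using eigen_eq_imp_bitrade[OF assms] by blast
  moreover have "bipartite_with_parts (T0 \<union> T1) (induced_edges E (T0 \<union> T1)) T0 T1"
    using assms(1) by (intro bipartite_induced[OF _ assms(4-6)]) (simp add: ksm_pair_def)
  ultimately show ?thesis
    unfolding eig reg by blast
qed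

end
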